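(* Let $A_1,\dots,A_m\in\mathbb{S}^n$, $b\in\mathbb{R}^m$, and $L:=\{X\in\mathbb{S}^n\mid\langle A_i,X\rangle=b_i\text{ for }i=1,\dots,m\}$, with $L\cap\mathbb{S}^n_+\neq\emptyset$. Assume that $L\cap\mathbb{S}^n_+$ does not satisfy Slater's condition, i.e. $L$ contains no positive definite matrix. Let $$\rho:=\max\{\operatorname{rank}(X)\mid X\in L\cap\mathbb{S}^n_+\}\qquad\text{and}\qquad d:=\mathrm{MSD}(L\cap\mathbb{S}^n_+),$$ and let $r^*$ be the smallest rank of a matrix $\sum_{i=1}^m A_iy_i$ over all $y\in\mathbb{R}^m$ satisfying $$\sum_{i=1}^m A_iy_i\in\mathbb{S}^n_+,\qquad \mathrm{tr}\Big(\sum_{i=1}^m A_iy_i\Big)=1,\qquad b^Ty=0.$$ Then $$r^*\le n-\rho-d+1.$$ Consequently, for every positive integer $r\le n$ with $r\ge n-\rho-d+1$, the non-linear system in the variables $(y,V)\in\mathbb{R}^m\times\mathbb{R}^{n\times r}$ $$\sum_{i=1}^m A_iy_i=VV^T,\qquad \mathrm{tr}\Big(\sum_{i=1}^m A_iy_i\Big)=1,\qquad b^Ty=0$$ has a nonzero solution. In particular, if $L\cap\mathbb{S}^n_+$ contains a nonzero matrix, then $r^*\le n-d$.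
   Context: $\mathbb{S}^n$ is the space of real symmetric $n\times n$ matrices with trace inner product $\langle X,Y\rangle=\mathrm{tr}(XY)$, and $\mathbb{S}^n_+$ the cone of positive semidefinite matrices. Write $K=\mathbb{S}^n_+$. For a cone $F$, $F^*=\{Y\mid\langle Y,X\rangle\ge 0\ \forall X\in F\}$; for a set $S$, $S^\perp=\{Y\mid \langle Y,X\rangle=0\ \forall X\in S\}$ (also when $S$ is an affine subspace), and $W^\perp:=\{W\}^\perp$. FR sequences and MSD. Facial reduction for $L\cap K$: set $F_0=K$; for $i=1,2,\dots$, as long as $L^\perp\cap(F_{i-1}^*\setminus F_{i-1}^\perp)\neq\emptyset$, choose any $w_i\in L^\perp\cap(F_{i-1}^*\setminus F_{i-1}^\perp)$ and set $F_i=F_{i-1}\cap w_i^\perp$. The procedure is run until it terminates, i.e. until $L^\perp\cap(F_k^*\setminus F_k^\perp)=\emptyset$, at which point $F_k$ is the smallest face of $K$ containing $L\cap K$. The resulting $(w_1,\dots,w_k)$ is called an FR sequence for $L\cap K$, of length $k$ (with $k=0$ if the procedure terminates immediately). The maximum singularity degree $\mathrm{MSD}(L\cap K)$ is the maximum length among all FR sequences for $L\cap K$. *)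

theory Defs
  imports "HOL-Analysis.Analysis"
begin

definition sym_mats :: "(real^'n^'n) set" where
  "sym_mats = {X. transpose X = X}"

definition psd_mats :: "(real^'n^'n) set" where
  "psd_mats = {X \<in> sym_mats. \<forall>x. 0 \<le> x \<bullet> (X *v x)}"

definition pd_mats :: "(real^'n^'n) set" where
  "pd_mats = {X \<in> sym_mats. \<forall>x. x \<noteq> 0 \<longrightarrow> 0 < x \<bullet> (X *v x)}"

definition tr_inner :: "real^'n^'n \<Rightarrow> real^'n^'n \<Rightarrow> real" where
  "tr_inner X Y = trace (X ** Y)"

text \<open>The ambient space is the space of symmetric matrices, so dual cones and orthogonal
  complements contain symmetric matrices only.\<close>

definition dual_cone :: "(real^'n^'n) set \<Rightarrow> (real^'n^'n) set" where
  "dual_cone F = {Y \<in> sym_mats. \<forall>X\<in>F. 0 \<le> tr_inner Y X}"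

definition perp :: "(real^'n^'n) set \<Rightarrow> (real^'n^'n) set" where
  "perp S = {Y \<in> sym_mats. \<forall>X\<in>S. tr_inner Y X = 0}"

definition affine_space_of :: "('m::finite \<Rightarrow> real^'n^'n) \<Rightarrow> real^'m \<Rightarrow> (real^'n^'n) set" where
  "affine_space_of A b = {X \<in> sym_mats. \<forall>i. tr_inner (A i) X = b $ i}"

definition lin_comb :: "('m::finite \<Rightarrow> real^'n^'n) \<Rightarrow> real^'m \<Rightarrow> real^'n^'n" where
  "lin_comb A y = (\<Sum>i\<in>UNIV. y $ i *\<^sub>R A i)"

definition reducing :: "(real^'n^'n) set \<Rightarrow> (real^'n^'n) set \<Rightarrow> (real^'n^'n) set" where
  "reducing L F = perp L \<inter> (dual_cone F - perp F)"

text \<open>\<open>fr_run L ws F\<close>: the steps \<open>ws\<close> of facial reduction for the intersection of \<open>L\<close> with the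
  positive semidefinite cone, not necessarily run until termination, lead to the face \<open>F\<close>.\<close>

inductive fr_run :: "(real^'n^'n) set \<Rightarrow> (real^'n^'n) list \<Rightarrow> (real^'n^'n) set \<Rightarrow> bool"
  for L where
  init: "fr_run L [] psd_mats"
| step: "fr_run L ws F \<Longrightarrow> w \<in> reducing L F \<Longrightarrow> fr_run L (ws @ [w]) (F \<inter> perp {w})"

definition fr_sequence :: "(real^'n^'n) set \<Rightarrow> (real^'n^'n) list \<Rightarrow> bool" where
  "fr_sequence L ws \<longleftrightarrow> (\<exists>F. fr_run L ws F \<and> reducing L F = {})"

text \<open>The set of lengths is finite and nonempty, because the faces of a run, and hence
  the dimensions of their spans, decrease strictly.\<close>

definition MSD :: "(real^'n^'n) set \<Rightarrow> nat" where
  "MSD L = Max {length ws | ws. fr_sequence L ws}"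

end

theory Submission
  imports Defs
begin

text \<open>The bound comes from counting dimensions along a longest run of facial reduction. Every face
  \<open>F\<close> of the semidefinite cone is governed by the subspace \<open>V\<close> of the vectors \<open>v\<close> with
  \<open>v v\<^sup>T \<in> F\<close>: since a positive semidefinite matrix is a sum of rank-one matrices \<open>v v\<^sup>T\<close>, and
  summands of an element of a face stay in the face, all matrices of \<open>F\<close> have their range in \<open>V\<close>
  (\<open>rank_le_dim_face_space\<close>). A reducing direction \<open>w\<close> is nonnegative but not identically zero
  on \<open>F\<close>, hence cuts out at least one dimension of \<open>V\<close> (\<open>face_space_step\<close>). The very first
  direction \<open>w\<^sub>1\<close> is itself semidefinite and cuts \<open>V\<close> down to its kernel, which costs
  \<open>rank w\<^sub>1\<close> dimensions at once (\<open>dim_face_space_first\<close>).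

  Let \<open>r\<^sup>*\<close> be the smallest rank of a possible first direction. After \<open>d \<ge> 1\<close> steps
  the subspace has dimension at most \<open>n - r\<^sup>* - (d - 1)\<close>. On the other hand \<open>L \<inter> K\<close> is contained
  in every face of the run, so this dimension is at least \<open>\<rho>\<close>. That is the asserted inequality
  (\<open>MSD_bound\<close>).

  Two facts link this to the matrices \<open>\<Sum> A\<^sub>i y\<^sub>i\<close>. By linear algebra \<open>L\<^sup>\<bottom>\<close> consists of
  those with \<open>b \<bullet> y = 0\<close> (\<open>perp_affine_space_of\<close>), so that the first directions are, after
  normalising the trace, the matrices over which \<open>r\<^sup>*\<close> is minimised. And if Slater's condition
  fails, separating \<open>L\<close> from the positive definite matrices yields such a direction
  (\<open>no_slater_imp_reducing\<close>), so \<open>d \<ge> 1\<close> and the minimum exists. Solvability of the non-linear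
  system is the fact that a semidefinite matrix of rank at most \<open>r\<close> is \<open>V V\<^sup>T\<close> with \<open>V\<close>
  having \<open>r\<close> columns.\<close>

section \<open>The trace form and rank-one matrices\<close>

lemma tr_inner_eq_inner:
  fixes X Y :: "real^'n^'n"
  assumes "X \<in> sym_mats"
  shows "tr_inner X Y = X \<bullet> Y"
proof -
  have X: "X $ j $ i = X $ i $ j" for i j
    using assms by (auto simp: sym_mats_def transpose_def vec_eq_iff)
  have "tr_inner X Y = (\<Sum>i\<in>UNIV. \<Sum>k\<in>UNIV. X $ k $ i * Y $ k $ i)"
    by (simp add: tr_inner_def trace_def matrix_matrix_mult_def X)
  also have "\<dots> = X \<bullet> Y"
    by (subst sum.swap) (simp add: inner_vec_def)
  finally show ?thesis .
qed

lemma sym_mats_inner_mult: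
  fixes X :: "real^'n^'n"
  assumes "X \<in> sym_mats"
  shows "x \<bullet> (X *v y) = (X *v x) \<bullet> y"
  using assms by (simp add: sym_mats_def flip: dot_lmul_matrix)
    (metis transpose_matrix_vector)

lemma subspace_sym_mats: "subspace (sym_mats :: (real^'n^'n) set)"
  by (auto simp: subspace_def sym_mats_def transpose_def vec_eq_iff)

definition rank_one :: "real^'n \<Rightarrow> real^'n^'n" where
  "rank_one v = (\<chi> i j. v $ i * v $ j)"

lemma rank_one_mult_vec: "rank_one v *v x = (v \<bullet> x) *\<^sub>R v"
  by (simp add: rank_one_def matrix_vector_mult_def vec_eq_iff inner_vec_def
      sum_distrib_right sum_distrib_left mult_ac)

lemma inner_rank_one:
  fixes X :: "real^'n^'n"
  shows "X \<bullet> rank_one v = v \<bullet> (X *v v)"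
  by (simp add: rank_one_def matrix_vector_mult_def inner_vec_def sum_distrib_left mult_ac)

lemma rank_one_sym: "rank_one v \<in> sym_mats"
  by (simp add: rank_one_def sym_mats_def transpose_def vec_eq_iff mult_ac)

lemma rank_one_psd: "rank_one v \<in> psd_mats"
  by (simp add: psd_mats_def rank_one_sym rank_one_mult_vec inner_commute)

lemma rank_one_scaleR: "rank_one (c *\<^sub>R v) = c\<^sup>2 *\<^sub>R rank_one v"
  by (simp add: rank_one_def vec_eq_iff power2_eq_square mult_ac)

text \<open>Its consequence for faces: if the right-hand side lies in a face, so does \<open>rank_one (u + v)\<close>.
  This is what makes the supporting sets below closed under addition.\<close>

lemma rank_one_parallelogram:
  "rank_one (u + v) + rank_one (u - v) = 2 *\<^sub>R rank_one u + 2 *\<^sub>R rank_one v"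
  by (simp add: rank_one_def vec_eq_iff algebra_simps)

lemma psd_mats_sym: "X \<in> psd_mats \<Longrightarrow> X \<in> sym_mats"
  by (simp add: psd_mats_def)

lemma psd_mats_add: "X \<in> psd_mats \<Longrightarrow> Y \<in> psd_mats \<Longrightarrow> X + Y \<in> psd_mats"
  using subspace_add[OF subspace_sym_mats, of X Y]
  by (simp add: psd_mats_def matrix_vector_mult_add_rdistrib inner_add_right)

lemma psd_mats_scaleR: "X \<in> psd_mats \<Longrightarrow> 0 \<le> c \<Longrightarrow> c *\<^sub>R X \<in> psd_mats"
  using subspace_scale[OF subspace_sym_mats, of X c]
  by (simp add: psd_mats_def flip: scaleR_matrix_vector_assoc)

lemma psd_mats_0: "0 \<in> psd_mats"
  using subspace_0[OF subspace_sym_mats] by (simp add: psd_mats_def)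

lemma psd_mats_sum: "(\<And>i. i \<in> I \<Longrightarrow> f i \<in> psd_mats) \<Longrightarrow> (\<Sum>i\<in>I. f i) \<in> psd_mats"
  by (induction I rule: infinite_finite_induct) (simp_all add: psd_mats_add psd_mats_0)

lemma span_range_mult_vec:
  fixes Z :: "real^'n^'m"
  shows "span (range (\<lambda>x. Z *v x)) = range (\<lambda>x. Z *v x)"
  by (intro span_eq_iff[THEN iffD2] linear_subspace_image matrix_vector_mul_linear subspace_UNIV)

lemma sum_matrix_vector_mult:
  fixes f :: "'a \<Rightarrow> real^'n^'m"
  shows "(\<Sum>i\<in>I. f i) *v x = (\<Sum>i\<in>I. f i *v x)"
  by (induction I rule: infinite_finite_induct) (auto simp: matrix_vector_mult_add_rdistrib)


section \<open>Factorisation of positive semidefinite matrices\<close>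

lemma psd_isotropic_imp_kernel:
  fixes X :: "real^'n^'n"
  assumes X: "X \<in> psd_mats" and u: "u \<bullet> (X *v u) = 0"
  shows "X *v u = 0"
proof (rule ccontr)
  assume ne: "X *v u \<noteq> 0"
  define w where "w = X *v u"
  define c where "c = w \<bullet> (X *v w)"
  have c0: "c \<ge> 0" and ww: "w \<bullet> w > 0"
    using X ne by (auto simp: c_def psd_mats_def w_def)
  \<comment> \<open>Moving from \<open>u\<close> a short way against the gradient \<open>w\<close> makes the form negative.\<close>
  define t where "t = (w \<bullet> w) / (c + 1)"
  have t: "t > 0" "t * c < 2 * (w \<bullet> w)"
    using c0 ww by (auto simp: t_def field_simps intro!: add_nonneg_pos)
  have sym: "u \<bullet> (X *v w) = w \<bullet> w"
    using sym_mats_inner_mult[OF psd_mats_sym[OF X]] by (simp add: w_def)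
  have "0 \<le> (u - t *\<^sub>R w) \<bullet> (X *v (u - t *\<^sub>R w))"
    using X by (simp add: psd_mats_def)
  also have "\<dots> = t * (t * c - 2 * (w \<bullet> w))"
    using u sym by (simp add: matrix_vector_mult_diff_distrib matrix_vector_mult_scaleR
        inner_diff_left inner_diff_right c_def flip: w_def) (simp add: algebra_simps)
  also have "\<dots> < 0"
    using t by (simp add: mult_pos_neg)
  finally show False by simp
qed

text \<open>For \<open>X u \<noteq> 0\<close> the matrix \<open>Y = X - X u (X u)\<^sup>T / (u\<^sup>T X u)\<close> is semidefinite by the
  Cauchy-Schwarz inequality for the form of \<open>X\<close>. Its range lies in that of \<open>X\<close> and misses \<open>X u\<close>,
  hence the rank drops.\<close>

lemma psd_deflation:
  fixes X :: "real^'n^'n"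
  assumes X: "X \<in> psd_mats" and X0: "X \<noteq> 0"
  obtains v Y where "Y \<in> psd_mats" "X = Y + rank_one v" "rank Y < rank X"
proof -
  obtain u where u: "X *v u \<noteq> 0"
    using X0 by (auto simp: matrix_eq)
  define q where "q = u \<bullet> (X *v u)"
  have q: "q > 0"
    using psd_isotropic_imp_kernel[OF X, of u] X u
    by (auto simp: q_def psd_mats_def less_le)
  note sym = sym_mats_inner_mult[OF psd_mats_sym[OF X]]
  define v where "v = (1 / sqrt q) *\<^sub>R (X *v u)"
  define Y where "Y = X - rank_one v"
  have Yv: "Y *v x = X *v x - (((X *v u) \<bullet> x) / q) *\<^sub>R (X *v u)" for x
  proof -
    have "1 / sqrt q * (1 / sqrt q) = 1 / q"
      using q by simp
    then show ?thesis
      by (simp add: Y_def matrix_vector_mult_diff_rdistrib rank_one_mult_vec v_def)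
  qed
  have Ysym: "Y \<in> sym_mats"
    unfolding Y_def by (intro subspace_diff[OF subspace_sym_mats] psd_mats_sym[OF X] rank_one_sym)
  have "0 \<le> x \<bullet> (Y *v x)" for x
  proof -
    define s where "s = ((X *v u) \<bullet> x) / q"
    have s: "s * q = (X *v u) \<bullet> x" using q by (simp add: s_def)
    \<comment> \<open>\<open>x - s u\<close> is the projection of \<open>x\<close> along \<open>u\<close> with respect to the form of \<open>X\<close>; there the form of
      \<open>X\<close> has the value of the form of \<open>Y\<close> at \<open>x\<close>.\<close>
    have "0 \<le> (x - s *\<^sub>R u) \<bullet> (X *v (x - s *\<^sub>R u))"
      using X by (simp add: psd_mats_def)
    also have "\<dots> = x \<bullet> (X *v x) - s * (x \<bullet> (X *v u)) - s * (u \<bullet> (X *v x)) + s * (s * q)"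
      unfolding q_def matrix_vector_mult_diff_distrib matrix_vector_mult_scaleR
      by (simp add: inner_diff_left inner_diff_right right_diff_distrib)
    also have "\<dots> = x \<bullet> (X *v x) - s * (x \<bullet> (X *v u))"
      unfolding s sym[of u x] by simp
    also have "\<dots> = x \<bullet> (Y *v x)"
      unfolding Yv s_def by (simp add: inner_diff_right)
    finally show ?thesis .
  qed
  then have Y: "Y \<in> psd_mats" using Ysym by (simp add: psd_mats_def)
  have "range (\<lambda>x. Y *v x) \<subseteq> range (\<lambda>x. X *v x)"
  proof clarify
    fix x
    have "Y *v x = X *v (x - (((X *v u) \<bullet> x) / q) *\<^sub>R u)"
      by (simp add: Yv matrix_vector_mult_diff_distrib matrix_vector_mult_scaleR)
    then show "Y *v x \<in> range (\<lambda>x. X *v x)" by (rule range_eqI)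
  qed
  moreover have "X *v u \<notin> range (\<lambda>x. Y *v x)"
  proof
    assume "X *v u \<in> range (\<lambda>x. Y *v x)"
    then obtain x where x: "X *v u = Y *v x" by auto
    \<comment> \<open>The range of \<open>Y\<close> is orthogonal to \<open>u\<close>, because \<open>Y *v u = 0\<close>.\<close>
    have "Y *v u = 0"
      using q by (simp add: Yv q_def inner_commute)
    then have "u \<bullet> (X *v u) = 0"
      unfolding x using sym_mats_inner_mult[OF Ysym, of u x] by simp
    then show False using q by (simp add: q_def)
  qed
  ultimately have "range (\<lambda>x. Y *v x) \<subset> range (\<lambda>x. X *v x)" by blast
  then have "rank Y < rank X"
    unfolding rank_dim_range by (intro dim_psubset) (simp only: span_range_mult_vec)
  moreover have "X = Y + rank_one v" by (simp add: Y_def)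
  ultimately show ?thesis using that[OF Y] by blast
qed

text \<open>Repeated deflation; the inequality \<open>rank X \<le> k\<close> lets the induction ignore by how much the rank
  drops, surplus summands being zero.\<close>

lemma psd_factorisation:
  fixes X :: "real^'n^'n"
  assumes "X \<in> psd_mats" "rank X \<le> k"
  shows "\<exists>v :: nat \<Rightarrow> real^'n. X = (\<Sum>i<k. rank_one (v i))"
  using assms
proof (induction k arbitrary: X)
  case 0
  then show ?case by (simp add: rank_eq_0)
next
  case (Suc k)
  show ?case
  proof (cases "X = 0")
    case True
    then show ?thesis
      by (intro exI[of _ "\<lambda>i. 0"]) (simp add: rank_one_def vec_eq_iff)
  next
    case False
    obtain v Y where Y: "Y \<in> psd_mats" "X = Y + rank_one v" "rank Y < rank X"
      using psd_deflation[OF Suc.prems(1) False] .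
    then obtain f where "Y = (\<Sum>i<k. rank_one (f i))"
      using Suc by (metis less_Suc_eq_le order_less_le_trans)
    then show ?thesis
      using Y by (intro exI[of _ "f(k := v)"]) simp
  qed
qed

lemma psd_gram_factorisation:
  fixes X :: "real^'n^'n"
  assumes "X \<in> psd_mats" "rank X \<le> CARD('r::finite)"
  obtains V :: "real^'r^'n" where "X = V ** transpose V"
proof -
  obtain v where v: "X = (\<Sum>i<CARD('r). rank_one (v i))"
    using psd_factorisation[OF assms] by blast
  obtain h where h: "bij_betw h (UNIV :: 'r set) {..<CARD('r)}"
    using finite_same_card_bij[of "UNIV :: 'r set" "{..<CARD('r)}"] by auto
  define V :: "real^'r^'n" where "V = (\<chi> i j. v (h j) $ i)"
  have "X = (\<Sum>j\<in>UNIV. rank_one (v (h j)))"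
    unfolding v by (rule sum.reindex_bij_betw[OF h, symmetric])
  also have "\<dots> = V ** transpose V"
    by (simp add: vec_eq_iff V_def matrix_matrix_mult_def transpose_def rank_one_def)
  finally show ?thesis by (rule that)
qed


lemma psd_trace_pos:
  fixes X :: "real^'n^'n"
  assumes X: "X \<in> psd_mats" and X0: "X \<noteq> 0"
  shows "trace X > 0"
proof -
  obtain v where v: "X = (\<Sum>i<rank X. rank_one (v i))"
    using psd_factorisation[OF X] by blast
  have tr: "trace Z = Z \<bullet> mat 1" for Z :: "real^'n^'n"
    by (simp add: trace_def inner_vec_def mat_def if_distrib cong: if_cong)
  have "trace X = mat 1 \<bullet> (\<Sum>i<rank X. rank_one (v i))"
    unfolding tr using v by (simp add: inner_commute)
  also have "\<dots> = (\<Sum>i<rank X. v i \<bullet> v i)"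
    by (simp add: inner_sum_right inner_rank_one)
  finally have t: "trace X = (\<Sum>i<rank X. v i \<bullet> v i)" .
  obtain j where "j < rank X" "v j \<noteq> 0"
  proof -
    have "\<exists>j<rank X. v j \<noteq> 0"
    proof (rule ccontr)
      assume "\<not> ?thesis"
      then have "X = 0" by (subst v) (simp add: rank_one_def vec_eq_iff)
      with X0 show False ..
    qed
    then show ?thesis using that by blast
  qed
  then show ?thesis unfolding t by (intro sum_pos2[of _ j]) auto
qed


section \<open>Faces of the semidefinite cone and their supporting subspaces\<close>

text \<open>The faces of the semidefinite cone that are convex cones, i.e. the nonempty ones. The last
  clause is stated for one summand, the other follows by commutativity.\<close>

definition psd_face :: "(real^'n^'n) set \<Rightarrow> bool" where
  "psd_face F \<longleftrightarrow> F \<subseteq> psd_mats \<and> 0 \<in> F \<and> (\<forall>X\<in>F. \<forall>Y\<in>F. X + Y \<in> F) \<and>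
     (\<forall>X\<in>F. \<forall>c\<ge>0. c *\<^sub>R X \<in> F) \<and>
     (\<forall>X\<in>psd_mats. \<forall>Y\<in>psd_mats. X + Y \<in> F \<longrightarrow> X \<in> F)"

text \<open>For a face this is the subspace \<open>V\<close> such that \<open>F\<close> consists of the semidefinite matrices with
  range in \<open>V\<close>.\<close>

definition face_space :: "(real^'n^'n) set \<Rightarrow> (real^'n) set" where
  "face_space F = {v. rank_one v \<in> F}"

lemma psd_face_psd_mats: "psd_face (psd_mats :: (real^'n^'n) set)"
  unfolding psd_face_def by (blast intro: psd_mats_0 psd_mats_add psd_mats_scaleR)

text \<open>A functional that is nonnegative on \<open>F\<close> and vanishes on a sum vanishes on both summands.\<close>

lemma psd_face_Int_perp:
  assumes F: "psd_face F" and w: "w \<in> dual_cone F"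
  shows "psd_face (F \<inter> perp {w})"
proof -
  have ws: "w \<in> sym_mats" and wF: "\<And>X. X \<in> F \<Longrightarrow> 0 \<le> w \<bullet> X"
    using w by (auto simp: dual_cone_def tr_inner_eq_inner)
  have Fs: "F \<subseteq> sym_mats"
    using F psd_mats_sym by (auto simp: psd_face_def)
  have eq: "F \<inter> perp {w} = {X\<in>F. w \<bullet> X = 0}"
    using Fs by (auto simp: perp_def tr_inner_eq_inner inner_commute)
  show ?thesis
    unfolding eq psd_face_def
  proof (intro conjI ballI impI allI)
    fix X Y assume X: "X \<in> psd_mats" and Y: "Y \<in> psd_mats"
      and XY: "X + Y \<in> {X\<in>F. w \<bullet> X = 0}"
    then have "X + Y \<in> F" "Y + X \<in> F" by (simp_all add: add.commute)
    then have "X \<in> F" "Y \<in> F"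
      using F X Y unfolding psd_face_def by blast+
    then show "X \<in> {X\<in>F. w \<bullet> X = 0}"
      using XY wF[of X] wF[of Y] by (auto simp: inner_add_right)
  qed (use F in \<open>auto simp: psd_face_def inner_add_right\<close>)
qed

lemma psd_face_summand:
  assumes "psd_face F" "finite I" "\<And>i. i \<in> I \<Longrightarrow> f i \<in> psd_mats" "(\<Sum>i\<in>I. f i) \<in> F" "j \<in> I"
  shows "f j \<in> F"
proof -
  have "(\<Sum>i\<in>I - {j}. f i) \<in> psd_mats" using assms(3) by (intro psd_mats_sum) auto
  moreover have "f j + (\<Sum>i\<in>I - {j}. f i) \<in> F"
    using assms by (simp add: sum.remove)
  ultimately show ?thesis
    using assms by (auto simp: psd_face_def)
qed

lemma psd_face_factorisation:
  fixes F :: "(real^'n^'n) set"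
  assumes F: "psd_face F" and X: "X \<in> F"
  obtains v and k :: nat where "X = (\<Sum>i<k. rank_one (v i))" "\<And>i. i < k \<Longrightarrow> v i \<in> face_space F"
proof -
  have "X \<in> psd_mats" using F X by (auto simp: psd_face_def)
  then obtain v where v: "X = (\<Sum>i<rank X. rank_one (v i))"
    using psd_factorisation by blast
  have "v i \<in> face_space F" if "i < rank X" for i
    using psd_face_summand[OF F, of "{..<rank X}" "\<lambda>i. rank_one (v i)" i] X v that
    by (simp add: rank_one_psd face_space_def)
  then show ?thesis using that v by blast
qed

lemma subspace_face_space:
  fixes F :: "(real^'n^'n) set"
  assumes F: "psd_face F"
  shows "subspace (face_space F)"
  unfolding subspace_def
proof (intro conjI ballI allI)
  have "rank_one 0 = (0 :: real^'n^'n)" by (simp add: rank_one_def vec_eq_iff)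
  then show "0 \<in> face_space F" using F unfolding face_space_def psd_face_def by simp
next
  fix x y assume "x \<in> face_space F" "y \<in> face_space F"
  then have "rank_one (x + y) + rank_one (x - y) \<in> F"
    unfolding rank_one_parallelogram using F by (simp add: face_space_def psd_face_def)
  then show "x + y \<in> face_space F"
    using F rank_one_psd[of "x + y"] rank_one_psd[of "x - y"]
    unfolding face_space_def psd_face_def by blast
next
  fix c x assume "x \<in> face_space F"
  then show "c *\<^sub>R x \<in> face_space F"
    using F by (simp add: face_space_def rank_one_scaleR psd_face_def)
qed

text \<open>Writing \<open>X\<close> as a sum of \<open>v\<^sub>i v\<^sub>i\<^sup>T\<close> with all \<open>v\<^sub>i\<close> in the subspace, \<open>X x = \<Sum> (v\<^sub>i \<bullet> x) v\<^sub>i\<close> lies in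
  it too.\<close>

lemma rank_le_dim_face_space:
  assumes F: "psd_face F" and X: "X \<in> F"
  shows "rank X \<le> dim (face_space F)"
proof -
  obtain v and k :: nat where v: "X = (\<Sum>i<k. rank_one (v i))" "\<And>i. i < k \<Longrightarrow> v i \<in> face_space F"
    using psd_face_factorisation[OF F X] by blast
  have "X *v x \<in> face_space F" for x
    unfolding v(1) sum_matrix_vector_mult rank_one_mult_vec
    by (intro subspace_sum[OF subspace_face_space[OF F]] subspace_scale[OF subspace_face_space[OF F]] v(2)) simp
  then show ?thesis
    unfolding rank_dim_range by (intro dim_subset) auto
qed

text \<open>If \<open>w\<close> does not vanish at \<open>X \<in> F\<close>, then it does not vanish at one of the rank-one summands
  \<open>v\<^sub>i v\<^sub>i\<^sup>T\<close> of \<open>X\<close>, and this \<open>v\<^sub>i\<close> is lost.\<close>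

lemma face_space_step:
  assumes F: "psd_face F" and w: "w \<in> dual_cone F - perp F"
  shows "dim (face_space (F \<inter> perp {w})) < dim (face_space F)"
proof -
  have ws: "w \<in> sym_mats" using w by (auto simp: dual_cone_def)
  obtain X where X: "X \<in> F" "w \<bullet> X \<noteq> 0"
    using w ws by (auto simp: perp_def tr_inner_eq_inner)
  obtain v and k :: nat where v: "X = (\<Sum>i<k. rank_one (v i))" "\<And>i. i < k \<Longrightarrow> v i \<in> face_space F"
    using psd_face_factorisation[OF F X(1)] by blast
  obtain i where i: "i < k" "w \<bullet> rank_one (v i) \<noteq> 0"
    using X(2) unfolding v(1) inner_sum_right by (metis (lifting) lessThan_iff sum.neutral)
  have "v i \<notin> face_space (F \<inter> perp {w})"
    using i(2) ws by (simp add: face_space_def perp_def tr_inner_eq_inner rank_one_sym inner_commute)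
  then have "face_space (F \<inter> perp {w}) \<subset> face_space F"
    using v(2)[OF i(1)] by (auto simp: face_space_def)
  moreover have "psd_face (F \<inter> perp {w})"
    using psd_face_Int_perp[OF F] w by auto
  ultimately show ?thesis
    by (metis F dim_psubset span_eq_iff subspace_face_space)
qed

text \<open>The surviving vectors are isotropic for \<open>w\<close>, hence in its kernel, which is orthogonal to its
  range.\<close>

lemma dim_face_space_first:
  fixes w :: "real^'n^'n"
  assumes w: "w \<in> psd_mats"
  shows "dim (face_space (psd_mats \<inter> perp {w})) + rank w \<le> CARD('n)"
proof -
  have ws: "w \<in> sym_mats" using w psd_mats_sym by auto
  let ?R = "range (\<lambda>x. w *v x)"
  have "face_space (psd_mats \<inter> perp {w}) \<subseteq> {y \<in> UNIV. \<forall>x\<in>?R. orthogonal x y}"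
  proof
    fix v assume "v \<in> face_space (psd_mats \<inter> perp {w})"
    then have "v \<bullet> (w *v v) = 0"
      by (simp add: face_space_def perp_def tr_inner_eq_inner rank_one_sym inner_commute[of _ w] inner_rank_one)
    then have "w *v v = 0" using psd_isotropic_imp_kernel[OF w] by simp
    then show "v \<in> {y \<in> UNIV. \<forall>x\<in>?R. orthogonal x y}"
      using sym_mats_inner_mult[OF ws, of _ v] by (auto simp: orthogonal_def simp flip: sym_mats_inner_mult[OF ws])
  qed
  then have "dim (face_space (psd_mats \<inter> perp {w})) \<le> dim {y \<in> UNIV. \<forall>x\<in>?R. orthogonal x y}"
    by (rule dim_subset)
  moreover have "dim {y \<in> UNIV. \<forall>x\<in>?R. orthogonal x y} + dim ?R = dim (UNIV :: (real^'n) set)"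
    by (intro dim_subspace_orthogonal_to_vectors linear_subspace_image matrix_vector_mul_linear subspace_UNIV) auto
  ultimately show ?thesis
    by (simp add: rank_dim_range)
qed


section \<open>Runs of facial reduction\<close>

lemma fr_run_face:
  assumes "fr_run L ws F"
  shows "psd_face F \<and> L \<inter> psd_mats \<subseteq> F"
  using assms
proof induction
  case init
  show ?case by (simp add: psd_face_psd_mats)
next
  case (step ws F w)
  have "X \<in> perp {w}" if "X \<in> L" "X \<in> psd_mats" for X
    using step.hyps(2) that psd_mats_sym[of X]
    by (auto simp: reducing_def perp_def tr_inner_eq_inner inner_commute)
  then show ?case
    using step psd_face_Int_perp[of F w] by (auto simp: reducing_def)
qed

lemma fr_run_dim:
  fixes L :: "(real^'n^'n) set"
  assumes "fr_run L ws F"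
  shows "dim (face_space F) + length ws \<le> CARD('n)"
  using assms
proof induction
  case init
  show ?case using dim_subset_UNIV[of "face_space (psd_mats :: (real^'n^'n) set)"] by simp
next
  case (step ws F w)
  then show ?case
    using face_space_step[of F w] fr_run_face[of L ws F] by (auto simp: reducing_def)
qed

lemma dual_cone_psd_mats:
  fixes w :: "real^'n^'n"
  assumes "w \<in> dual_cone psd_mats"
  shows "w \<in> psd_mats"
proof -
  have "w \<in> sym_mats" "\<And>v. 0 \<le> w \<bullet> rank_one v"
    using assms by (auto simp: dual_cone_def rank_one_psd simp flip: tr_inner_eq_inner)
  then show ?thesis by (simp add: psd_mats_def inner_rank_one)
qed

text \<open>Compared with \<open>fr_run_dim\<close>, the first step is charged at least \<open>r\<close> instead of 1.\<close>

lemma fr_run_dim_first_rank: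
  fixes L :: "(real^'n^'n) set"
  assumes "fr_run L ws F" "ws \<noteq> []"
    and r: "\<And>w. w \<in> reducing L psd_mats \<Longrightarrow> r \<le> rank w"
  shows "dim (face_space F) + length ws + r \<le> CARD('n) + 1"
  using assms(1,2)
proof induction
  case init
  then show ?case by simp
next
  case (step ws F w)
  show ?case
  proof (cases "ws = []")
    case True
    then have F: "F = psd_mats"
      using step.hyps(1) by (auto elim: fr_run.cases)
    then have "w \<in> psd_mats"
      using step.hyps(2) dual_cone_psd_mats by (auto simp: reducing_def)
    then show ?thesis
      using dim_face_space_first[of w] r[of w] step.hyps(2) True F by simp
  next
    case False
    then show ?thesis
      using step face_space_step[of F w] fr_run_face[of L ws F] by (auto simp: reducing_def)
  qed
qed

text \<open>The dimension count bounds the length of every run, so a run of greatest length exists, and it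
  cannot be continued.\<close>

lemma fr_sequence_longest:
  fixes L :: "(real^'n^'n) set"
  obtains ws where "fr_sequence L ws" "length ws = MSD L"
proof -
  let ?S = "{length ws | ws. fr_sequence L ws}"
  have "?S \<subseteq> {..CARD('n)}"
    using fr_run_dim[of L] by (force simp: fr_sequence_def)
  then have fin: "finite ?S" using finite_subset by blast
  let ?P = "\<lambda>ws. \<exists>F. fr_run L ws F"
  have "?P []" using fr_run.init by blast
  moreover have "\<forall>ws. ?P ws \<longrightarrow> length ws < Suc CARD('n)"
    using fr_run_dim[of L] by (force simp: less_Suc_eq_le)
  ultimately obtain ws where ws: "?P ws" "\<And>us. ?P us \<Longrightarrow> length us \<le> length ws"
    using ex_has_greatest_nat[of ?P "[]" length "Suc CARD('n)"] by blast
  then obtain F where F: "fr_run L ws F" by blast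
  have "reducing L F = {}"
  proof (rule ccontr)
    assume "reducing L F \<noteq> {}"
    then obtain w where "w \<in> reducing L F" by blast
    then have "?P (ws @ [w])" using fr_run.step[OF F] by blast
    then show False using ws(2) by fastforce
  qed
  then have "?S \<noteq> {}" using F by (auto simp: fr_sequence_def)
  then have "MSD L \<in> ?S" using Max_in[OF fin] by (simp add: MSD_def)
  then show ?thesis using that by auto
qed

text \<open>The hypothesis that a first reducing direction exists rules out the empty sequence, to which the
  charge \<open>r\<close> for the first step would not apply.\<close>

lemma MSD_bound:
  fixes L :: "(real^'n^'n) set"
  assumes ne: "reducing L psd_mats \<noteq> {}"
    and r: "\<And>w. w \<in> reducing L psd_mats \<Longrightarrow> r \<le> rank w"
    and X: "X \<in> L \<inter> psd_mats"
  shows "rank X + MSD L + r \<le> CARD('n) + 1"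
proof -
  obtain ws where ws: "fr_sequence L ws" "length ws = MSD L"
    using fr_sequence_longest .
  then obtain F where F: "fr_run L ws F" "reducing L F = {}"
    by (auto simp: fr_sequence_def)
  have "ws \<noteq> []"
    using F ne by (auto elim: fr_run.cases)
  then have "dim (face_space F) + length ws + r \<le> CARD('n) + 1"
    using fr_run_dim_first_rank[OF F(1)] r by blast
  moreover have "rank X \<le> dim (face_space F)"
    using rank_le_dim_face_space[of F X] fr_run_face[OF F(1)] X by blast
  ultimately show ?thesis using ws by linarith
qed


section \<open>Affine sections of the semidefinite cone\<close>

lemma reducing_psd_mats:
  "reducing L psd_mats = {w \<in> perp L. w \<in> psd_mats \<and> w \<noteq> 0}" for L :: "(real^'n^'n) set"
proof (intro equalityI subsetI)
  fix w assume w: "w \<in> reducing L psd_mats"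
  then have "w \<noteq> 0"
    using subspace_0[OF subspace_sym_mats]
    by (auto simp: reducing_def perp_def tr_inner_eq_inner)
  then show "w \<in> {w \<in> perp L. w \<in> psd_mats \<and> w \<noteq> 0}"
    using w dual_cone_psd_mats by (auto simp: reducing_def)
next
  fix w assume w: "w \<in> {w \<in> perp L. w \<in> psd_mats \<and> w \<noteq> 0}"
  then have ws: "w \<in> sym_mats" by (simp add: psd_mats_sym)
  have "0 \<le> w \<bullet> X" if X: "X \<in> psd_mats" for X
  proof -
    obtain v where "X = (\<Sum>i<rank X. rank_one (v i))"
      using psd_factorisation[OF X] by blast
    then have "w \<bullet> X = (\<Sum>i<rank X. v i \<bullet> (w *v v i))"
      by (metis (mono_tags, lifting) inner_rank_one inner_sum_right sum.cong)
    also have "\<dots> \<ge> 0"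
      using w by (intro sum_nonneg) (simp add: psd_mats_def)
    finally show ?thesis .
  qed
  then have "w \<in> dual_cone psd_mats"
    using ws by (simp add: dual_cone_def tr_inner_eq_inner)
  moreover have "w \<notin> perp psd_mats"
    using w ws by (auto simp: perp_def tr_inner_eq_inner intro!: bexI[of _ w])
  ultimately show "w \<in> reducing L psd_mats"
    using w by (simp add: reducing_def)
qed

text \<open>Split \<open>w \<in> L\<^sup>\<bottom>\<close> orthogonally into a combination of the \<open>A\<^sub>i\<close> and a remainder. The remainder is
  symmetric and a direction of \<open>L\<close>, hence orthogonal to \<open>w\<close>, hence zero. The condition
  \<open>b \<bullet> y = 0\<close> then says that \<open>w\<close> vanishes at a point of \<open>L\<close>.\<close>

lemma perp_affine_space_of:
  fixes A :: "'m::finite \<Rightarrow> real^'n^'n"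
  assumes A: "\<And>i. A i \<in> sym_mats" and ne: "affine_space_of A b \<noteq> {}"
  shows "perp (affine_space_of A b) = {lin_comb A y | y. b \<bullet> y = 0}"
proof (intro equalityI subsetI)
  obtain X0 where X0: "X0 \<in> affine_space_of A b" using ne by blast
  have AX: "A i \<bullet> X = b $ i" if "X \<in> affine_space_of A b" for X i
    using that A by (simp add: affine_space_of_def tr_inner_eq_inner)
  have lin: "lin_comb A y \<bullet> X = b \<bullet> y" if "X \<in> affine_space_of A b" for X y
    using AX[OF that] by (simp add: lin_comb_def inner_sum_left inner_vec_def[of b] mult.commute)
  {
    fix w assume w: "w \<in> {lin_comb A y | y. b \<bullet> y = 0}"
    then have "w \<in> sym_mats"
      using A by (auto simp: lin_comb_def intro!: subspace_sum[OF subspace_sym_mats] subspace_scale[OF subspace_sym_mats])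
    then show "w \<in> perp (affine_space_of A b)"
      using w lin by (auto simp: perp_def tr_inner_eq_inner)
  }
  fix w assume "w \<in> perp (affine_space_of A b)"
  then have ws: "w \<in> sym_mats" and wX: "\<And>X. X \<in> affine_space_of A b \<Longrightarrow> w \<bullet> X = 0"
    by (auto simp: perp_def tr_inner_eq_inner)
  obtain p q where p: "p \<in> span (range A)" and q: "\<And>u. u \<in> span (range A) \<Longrightarrow> orthogonal q u"
    and wpq: "w = p + q"
    using orthogonal_subspace_decomp_exists[of "range A" w] by metis
  have "p \<in> sym_mats"
    using p A span_minimal[OF _ subspace_sym_mats, of "range A"] by blast
  then have qs: "q \<in> sym_mats"
    using subspace_diff[OF subspace_sym_mats ws, of p] wpq by simp
  \<comment> \<open>\<open>q\<close> is a direction of the affine space, so \<open>w\<close> is orthogonal to it.\<close>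
  have "A i \<bullet> q = 0" for i
    using q[of "A i"] by (simp add: span_base orthogonal_def inner_commute)
  then have "X0 + q \<in> affine_space_of A b"
    using X0 A qs subspace_add[OF subspace_sym_mats, of X0 q]
    by (simp add: affine_space_of_def tr_inner_eq_inner inner_add_right)
  then have "w \<bullet> q = 0"
    using wX[OF X0] wX[of "X0 + q"] by (simp add: inner_add_right)
  moreover have "p \<bullet> q = 0"
    using q[OF p] by (simp add: orthogonal_def inner_commute)
  ultimately have "q = 0" by (simp add: wpq inner_add_left)
  then have "w \<in> span (range A)" using p wpq by simp
  moreover have "span (range A) \<subseteq> range (lin_comb A)"
  proof (rule span_minimal)
    have "A i = lin_comb A (axis i 1)" for i
      by (simp add: lin_comb_def axis_def if_distrib[of "\<lambda>c. c *\<^sub>R _"] cong: if_cong)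
    then show "range A \<subseteq> range (lin_comb A)" by blast
    have "linear (lin_comb A)"
      unfolding lin_comb_def
      by (rule linearI) (simp_all add: algebra_simps sum.distrib scaleR_sum_right)
    then show "subspace (range (lin_comb A))"
      by (intro linear_subspace_image subspace_UNIV)
  qed
  ultimately obtain y where "w = lin_comb A y" by blast
  then show "w \<in> {lin_comb A y | y. b \<bullet> y = 0}"
    using wX[OF X0] lin[OF X0, of y] by auto
qed

text \<open>Separate \<open>L\<close> from the cone \<open>P\<close> of all, not necessarily symmetric, matrices with positive
  quadratic form. The symmetric ones among them alone could be separated by an antisymmetric normal
  vector, which is useless; the larger cone contains \<open>1 + K\<close> for every antisymmetric \<open>K\<close>, which forces
  the normal vector to be symmetric. A feasible point then shows that the separating functional
  vanishes on all of \<open>L\<close>.\<close>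

lemma no_slater_imp_reducing:
  fixes A :: "'m::finite \<Rightarrow> real^'n^'n"
  assumes A: "\<And>i. A i \<in> sym_mats"
    and L: "L = affine_space_of A b"
    and feasible: "L \<inter> psd_mats \<noteq> {}"
    and no_slater: "L \<inter> pd_mats = {}"
  shows "reducing L psd_mats \<noteq> {}"
proof -
  obtain X0 where X0: "X0 \<in> L" "X0 \<in> psd_mats" using feasible by blast
  define P :: "(real^'n^'n) set" where "P = {X. \<forall>x. x \<noteq> 0 \<longrightarrow> 0 < x \<bullet> (X *v x)}"
  have Leq: "X \<in> L \<longleftrightarrow> X \<in> sym_mats \<and> (\<forall>i. A i \<bullet> X = b $ i)" for X
    using A by (simp add: L affine_space_of_def tr_inner_eq_inner)
  have Laff: "(1 - t) *\<^sub>R X + t *\<^sub>R Y \<in> L" if "X \<in> L" "Y \<in> L" for X Y t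
  proof -
    have "(1 - t) *\<^sub>R X + t *\<^sub>R Y \<in> sym_mats"
      using that by (intro subspace_add subspace_scale subspace_sym_mats) (auto simp: Leq)
    then show ?thesis
      using that by (auto simp: Leq inner_add_right) (simp add: algebra_simps)
  qed
  have Padd: "X + Y \<in> P" if "X \<in> P" "\<And>x. 0 \<le> x \<bullet> (Y *v x)" for X Y
    using that by (auto simp: P_def matrix_vector_mult_add_rdistrib inner_add_right add_pos_nonneg)
  have Pscale: "c *\<^sub>R X \<in> P" if "X \<in> P" "c > 0" for X c
    using that by (auto simp: P_def simp flip: scaleR_matrix_vector_assoc)
  have Pnonneg: "0 \<le> x \<bullet> (X *v x)" if "X \<in> P" for X x
    using that by (cases "x = 0") (auto simp: P_def less_imp_le)
  have one: "mat 1 \<in> P" by (simp add: P_def)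
  have "convex L"
    using Laff by (simp add: convex_alt)
  moreover have "convex P"
    unfolding convex_alt
  proof clarify
    fix X Y :: "real^'n^'n" and t :: real assume XY: "X \<in> P" "Y \<in> P" and t: "0 \<le> t" "t \<le> 1"
    show "(1 - t) *\<^sub>R X + t *\<^sub>R Y \<in> P"
    proof (cases "t = 1")
      case False
      with t have "(1 - t) *\<^sub>R X \<in> P" by (intro Pscale XY) simp
      then show ?thesis
        using t Pnonneg[OF XY(2)] by (intro Padd) (simp_all flip: scaleR_matrix_vector_assoc)
    qed (simp add: XY)
  qed
  moreover have "L \<inter> P = {}"
    using no_slater by (auto simp: P_def pd_mats_def Leq)
  ultimately obtain w c where w0: "w \<noteq> 0" and wL: "\<And>X. X \<in> L \<Longrightarrow> w \<bullet> X \<le> c"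
    and wP: "\<And>X. X \<in> P \<Longrightarrow> c \<le> w \<bullet> X"
    using separating_hyperplane_sets[of L P] X0 one by blast
  \<comment> \<open>\<open>w\<close> is bounded below on \<open>P\<close>, which contains the ray from the identity in direction \<open>Y\<close>; at
    the parameter \<open>t\<close> a negative slope would bring it below \<open>c\<close>.\<close>
  have bdd: "0 \<le> w \<bullet> Y" if "\<And>x. 0 \<le> x \<bullet> (Y *v x)" for Y
  proof (rule ccontr)
    assume neg: "\<not> 0 \<le> w \<bullet> Y"
    define t where "t = (\<bar>w \<bullet> mat 1 - c\<bar> + 1) / - (w \<bullet> Y)"
    have t: "t \<ge> 0" "t * (w \<bullet> Y) = - (\<bar>w \<bullet> mat 1 - c\<bar> + 1)"
      using neg by (auto simp: t_def field_simps)
    have "mat 1 + t *\<^sub>R Y \<in> P"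
      using t that by (intro Padd one) (simp flip: scaleR_matrix_vector_assoc)
    from wP[OF this] show False using t by (simp add: inner_add_right)
  qed
  \<comment> \<open>\<open>P\<close> contains arbitrarily small multiples of the identity.\<close>
  have "c \<le> 0"
  proof (rule ccontr)
    assume c: "\<not> c \<le> 0"
    define t where "t = c / (2 * (\<bar>w \<bullet> mat 1\<bar> + 1))"
    have t: "t > 0" "t * (\<bar>w \<bullet> mat 1\<bar> + 1) = c / 2"
      using c by (auto simp: t_def add_pos_nonneg field_simps)
    have "c \<le> t * (w \<bullet> mat 1)" using wP[OF Pscale[OF one t(1)]] by simp
    also have "\<dots> \<le> t * (\<bar>w \<bullet> mat 1\<bar> + 1)" using t(1) by (intro mult_left_mono) auto
    finally show False using t c by simp
  qed
  have X00: "w \<bullet> X0 = 0"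
    using bdd[of X0] X0 wL[of X0] \<open>c \<le> 0\<close> by (auto simp: psd_mats_def)
  have wL0: "w \<bullet> X = 0" if X: "X \<in> L" for X
  proof -
    \<comment> \<open>The reflection of \<open>X\<close> in \<open>X0\<close> lies in \<open>L\<close> as well.\<close>
    have "w \<bullet> ((1 - 2) *\<^sub>R X + 2 *\<^sub>R X0) \<le> c" by (intro wL Laff X X0)
    then show ?thesis using wL[OF X] X00 \<open>c \<le> 0\<close> by (simp add: inner_diff_right)
  qed
  \<comment> \<open>Antisymmetric matrices have zero quadratic form, so \<open>w\<close> is orthogonal to them.\<close>
  have "w \<bullet> (w - transpose w) = 0"
  proof -
    have q: "x \<bullet> ((w - transpose w) *v x) = 0" for x
      by (simp add: matrix_vector_mult_diff_rdistrib inner_diff_right)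
        (metis dot_lmul_matrix inner_commute)
    have "0 \<le> w \<bullet> (w - transpose w)" by (intro bdd) (simp add: q)
    moreover have "0 \<le> w \<bullet> (- (w - transpose w))"
    proof (rule bdd)
      fix x
      have "- (w - transpose w) = (-1) *\<^sub>R (w - transpose w)" by simp
      then show "0 \<le> x \<bullet> (- (w - transpose w) *v x)"
        by (metis (no_types, lifting) inner_scaleR_right mult_zero_right order_refl q scaleR_matrix_vector_assoc)
    qed
    ultimately show ?thesis by (simp add: inner_diff_right)
  qed
  moreover have "transpose w \<bullet> transpose w = w \<bullet> w"
    unfolding inner_vec_def transpose_def by (simp, subst sum.swap, simp)
  ultimately have "(w - transpose w) \<bullet> (w - transpose w) = 0"
    by (simp add: inner_diff_left inner_diff_right inner_commute)
  then have ws: "w \<in> sym_mats" by (simp add: sym_mats_def)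
  have "0 \<le> x \<bullet> (w *v x)" for x
    using bdd[of "rank_one x"] rank_one_psd[of x] by (simp add: inner_rank_one psd_mats_def)
  then have "w \<in> psd_mats" using ws by (simp add: psd_mats_def)
  moreover have "w \<in> perp L"
    using ws wL0 by (simp add: perp_def tr_inner_eq_inner)
  ultimately show ?thesis using w0 by (auto simp: reducing_psd_mats)
qed


section \<open>The rank bound\<close>

theorem proposition2p4:
  fixes A :: "'m::finite \<Rightarrow> real^'n^'n" and b :: "real^'m"
    and L :: "(real^'n^'n) set" and \<rho> d rstar :: nat
  assumes A: "\<And>i. A i \<in> sym_mats"
    and L: "L = affine_space_of A b"
    and feasible: "L \<inter> psd_mats \<noteq> {}"
    and no_slater: "L \<inter> pd_mats = {}"
    and rho: "\<rho> = Max {rank X | X. X \<in> L \<inter> psd_mats}"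
    and d: "d = MSD L"
    and rstar: "rstar = Min {rank (lin_comb A y) | y.
      lin_comb A y \<in> psd_mats \<and> trace (lin_comb A y) = 1 \<and> b \<bullet> y = 0}"
  shows "int rstar \<le> int CARD('n) - int \<rho> - int d + 1
    \<and> (CARD('r::finite) \<le> CARD('n) \<and> int CARD('r) \<ge> int CARD('n) - int \<rho> - int d + 1 \<longrightarrow>
        (\<exists>(y :: real^'m) (V :: real^'r^'n). (y, V) \<noteq> (0, 0)
          \<and> lin_comb A y = V ** transpose V \<and> trace (lin_comb A y) = 1 \<and> b \<bullet> y = 0))
    \<and> ((\<exists>X \<in> L \<inter> psd_mats. X \<noteq> 0) \<longrightarrow> int rstar \<le> int CARD('n) - int d)"
proof -
  let ?R = "{rank X | X. X \<in> L \<inter> psd_mats}"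
  let ?S = "{rank (lin_comb A y) | y.
      lin_comb A y \<in> psd_mats \<and> trace (lin_comb A y) = 1 \<and> b \<bullet> y = 0}"
  have rank_le: "rank X \<le> CARD('n)" for X :: "real^'n^'n"
    using rank_bound[of X] by simp
  have finS: "finite ?S" and finR: "finite ?R"
    by (rule finite_subset[of _ "{..CARD('n)}"]; use rank_le in auto)+
  have perpL: "perp L = {lin_comb A y | y. b \<bullet> y = 0}"
    using perp_affine_space_of[of A b] A feasible L by blast
  have normalised: "rank w \<in> ?S" if w: "w \<in> reducing L psd_mats" for w
  proof -
    have psd: "w \<in> psd_mats" "w \<noteq> 0" and "w \<in> perp L"
      using w by (auto simp: reducing_psd_mats)
    then obtain y where y: "w = lin_comb A y" "b \<bullet> y = 0"
      unfolding perpL by blast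
    have t: "trace w > 0" using psd_trace_pos psd by blast
    define c where "c = 1 / trace w"
    have c: "c > 0" using t by (simp add: c_def)
    have cw: "lin_comb A (c *\<^sub>R y) = c *\<^sub>R w"
      by (simp add: y lin_comb_def scaleR_sum_right)
    have "c *\<^sub>R w \<in> psd_mats"
      using psd c by (simp add: psd_mats_scaleR)
    moreover have "trace (c *\<^sub>R w) = c * trace w"
      by (simp add: trace_def sum_distrib_left)
    then have "trace (c *\<^sub>R w) = 1" using t by (simp add: c_def)
    moreover have "rank (c *\<^sub>R w) = rank w"
    proof -
      have "(\<lambda>x. (c *\<^sub>R w) *v x) = (\<lambda>x. w *v x) \<circ> (\<lambda>x. c *\<^sub>R x)"
        by (auto simp: fun_eq_iff matrix_vector_mult_scaleR simp flip: scaleR_matrix_vector_assoc)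
      moreover have "range (\<lambda>x::real^'n. c *\<^sub>R x) = UNIV"
        using c by (intro surjI[of _ "\<lambda>x. (1 / c) *\<^sub>R x"]) simp
      ultimately show ?thesis
        unfolding rank_dim_range by (metis image_comp)
    qed
    ultimately show ?thesis
      using y cw by (intro CollectI exI[of _ "c *\<^sub>R y"]) auto
  qed
  have ne: "reducing L psd_mats \<noteq> {}"
    using no_slater_imp_reducing[OF A L feasible no_slater] .
  have rmin: "rstar \<le> rank w" if "w \<in> reducing L psd_mats" for w
    unfolding rstar using normalised[OF that] by (intro Min_le finS)
  have "rstar \<in> ?S"
    unfolding rstar using normalised ne by (intro Min_in finS) blast
  then obtain y where y: "rstar = rank (lin_comb A y)" "lin_comb A y \<in> psd_mats"
      "trace (lin_comb A y) = 1" "b \<bullet> y = 0"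
    by blast
  have "\<rho> \<in> ?R"
    unfolding rho using feasible by (intro Max_in finR) blast
  then obtain X where X: "X \<in> L \<inter> psd_mats" "rank X = \<rho>" by blast
  have bound: "\<rho> + d + rstar \<le> CARD('n) + 1"
    using MSD_bound[OF ne rmin X(1)] X d by simp
  show ?thesis
  proof (intro conjI impI)
    show "int rstar \<le> int CARD('n) - int \<rho> - int d + 1" using bound by linarith
  next
    assume "CARD('r) \<le> CARD('n) \<and> int CARD('r) \<ge> int CARD('n) - int \<rho> - int d + 1"
    then have "rank (lin_comb A y) \<le> CARD('r)" using bound y(1) by linarith
    then obtain V :: "real^'r^'n" where V: "lin_comb A y = V ** transpose V"
      using psd_gram_factorisation[OF y(2)] by blast
    have "y \<noteq> 0"
      using y(3) by (auto simp: lin_comb_def trace_def)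
    then show "\<exists>(y :: real^'m) (V :: real^'r^'n). (y, V) \<noteq> (0, 0)
          \<and> lin_comb A y = V ** transpose V \<and> trace (lin_comb A y) = 1 \<and> b \<bullet> y = 0"
      using V y by blast
  next
    assume "\<exists>X \<in> L \<inter> psd_mats. X \<noteq> 0"
    then obtain Z where Z: "Z \<in> L \<inter> psd_mats" "Z \<noteq> 0" by blast
    then have "rank Z \<le> \<rho>" unfolding rho by (intro Max_ge finR) blast
    moreover have "rank Z \<noteq> 0" using Z by (simp add: rank_eq_0)
    ultimately show "int rstar \<le> int CARD('n) - int d" using bound by linarith
  qed
qed

end
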